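(* For every $\phi\in[0,1]$, the minimum of $F(\mu)$ over $\mu\in\mathcal{M}_\phi$ is attained at some $\mu$ supported on at most two points. Furthermore, if a minimizer is supported on exactly two points, then one of the two points is $0$.
   Context: Let $H(x)=-x\log x-(1-x)\log(1-x)$ for $x\in[0,1]$ (natural logarithm, with $0\log 0=0$) be the entropy function. For $\phi\in[0,1]$, let $\mathcal{M}_\phi$ be the set of Borel probability measures $\mu$ on $[0,1]$ with $\int x\,\mu(\mathrm{d}x)=\phi$. For $\mu\in\mathcal{M}_\phi$ define $F(\mu)=\mathbb{E}_{(x,y)\sim\mu\times\mu}H(xy)-\mathbb{E}_{x\sim\mu}H(x)$, where $x,y$ are independent samples from $\mu$. ($F$ is continuous in the weak topology and $\mathcal{M}_\phi$ is compact, so a minimizer exists.) *)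

theory Defs
  imports "HOL-Probability.Probability"
begin

(* The convention 0 log 0 = 0 holds automatically, since 0 * ln 0 = 0 in HOL. *)
definition entropy_fun :: "real \<Rightarrow> real" where
  "entropy_fun x = - x * ln x - (1 - x) * ln (1 - x)"

definition mean_measures :: "real \<Rightarrow> real measure set" where
  "mean_measures \<phi> = {\<mu>. prob_space \<mu> \<and>
     sets \<mu> = sets (restrict_space borel {0..1}) \<and> (LINT x|\<mu>. x) = \<phi>}"

definition entropy_functional :: "real measure \<Rightarrow> real" where
  "entropy_functional \<mu> =
     (LINT (x, y)|(\<mu> \<Otimes>\<^sub>M \<mu>). entropy_fun (x * y)) - (LINT x|\<mu>. entropy_fun x)"

(* Topological support inside the carrier: the sets U \<inter> space \<mu> are the relatively open ones. *)
definition measure_support :: "'a::topological_space measure \<Rightarrow> 'a set" where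
  "measure_support \<mu> =
     {x \<in> space \<mu>. \<forall>U. open U \<and> x \<in> U \<longrightarrow> emeasure \<mu> (U \<inter> space \<mu>) > 0}"

definition is_minimizer :: "real \<Rightarrow> real measure \<Rightarrow> bool" where
  "is_minimizer \<phi> = is_arg_min entropy_functional (\<lambda>\<mu>. \<mu> \<in> mean_measures \<phi>)"

end

theory Submission
  imports Defs "HOL-Real_Asymp.Real_Asymp"
begin

text \<open>
  Let \<open>H\<close> be the entropy function and let \<open>\<mu>\<close> be a minimizer with mean in
  \<open>(0, 1)\<close>. Moving \<open>\<mu>\<close> towards a two-point measure of the same mean shows that
  the potential \<open>G x = 2 (\<integral>y. H (x y) \<partial>\<mu>) - H x\<close> lies above an affine
  function \<open>l\<close>, with equality \<open>\<mu>\<close>-almost everywhere, hence on the support.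
  Moreover \<open>x (1 - x) G'' x = 1 - 2 (\<integral>y. y (1 - x) / (1 - x y) \<partial>\<mu>)\<close> is
  strictly increasing in \<open>x\<close> unless \<open>\<mu>\<close> lives on \<open>{0, 1}\<close>. If
  \<open>a > 0\<close> is a zero of \<open>G - l\<close> with \<open>a < 1\<close>, then it is an interior
  minimum, so \<open>G'' a \<ge> 0\<close> and \<open>G'' > 0\<close> to the right of \<open>a\<close>;
  therefore \<open>G - l\<close> has no further zero there, and the support contains at most one positive
  point. A minimizer exists by compactness: Skorohod's theorem turns a weakly convergent minimizing sequence
  into a pointwise convergent sequence of random variables, along which the functional converges by dominated
  convergence.
\<close>

section \<open>Continuity and derivative of entropy; differentiation under the integral\<close>

text \<open>The only delicate point is 0, where the conventional value \<open>0 * ln 0 = 0\<close>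
  agrees with the one-sided limit.\<close>

lemma continuous_on_x_ln_x: "continuous_on {0..} (\<lambda>x::real. x * ln x)"
proof -
  have lim: "((\<lambda>x::real. x * ln x) \<longlongrightarrow> 0) (at_right 0)" by real_asymp
  have at0: "at 0 within {0..} = at_right (0::real)"
    by (simp add: at_within_Ici_at_right)
  show ?thesis
    unfolding continuous_on_def
  proof (rule ballI)
    fix x :: real
    show "((\<lambda>x. x * ln x) \<longlongrightarrow> x * ln x) (at x within {0..})"
      using lim by (cases "x = 0") (auto simp: at0 intro!: tendsto_eq_intros)
  qed
qed

lemma is_minimizer_iff:
  "is_minimizer \<phi> \<mu> \<longleftrightarrow> \<mu> \<in> mean_measures \<phi> \<and>
    (\<forall>\<nu>\<in>mean_measures \<phi>. entropy_functional \<mu> \<le> entropy_functional \<nu>)"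
  by (auto simp: is_minimizer_def is_arg_min_linorder)

lemma continuous_on_entropy_fun: "continuous_on {0..1} entropy_fun"
proof -
  have "continuous_on {0..1} (\<lambda>x::real. - (x * ln x) - (\<lambda>x. x * ln x) (1-x))"
    by (intro continuous_intros continuous_on_subset[OF continuous_on_x_ln_x]
        continuous_on_compose2[OF continuous_on_x_ln_x]) auto
  then show ?thesis by (simp add: entropy_fun_def cong: continuous_on_cong)
qed

lemma borel_measurable_entropy_fun [measurable]: "entropy_fun \<in> borel_measurable borel"
  unfolding entropy_fun_def by measurable

text \<open>The mean value inequality bounds all difference quotients by \<open>C\<close>, a
  constant that is integrable over a finite measure, so dominated convergence applies along every
  sequence tending to \<open>a\<close>.\<close>

lemma (in finite_measure) has_real_derivative_lebesgue_integral:
  fixes f f' :: "real \<Rightarrow> 'a \<Rightarrow> real"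
  assumes a: "a \<in> {p<..<q}"
    and f: "\<And>x. x \<in> {p<..<q} \<Longrightarrow> integrable M (f x)"
    and f': "f' a \<in> borel_measurable M"
    and deriv: "\<And>x y. x \<in> {p<..<q} \<Longrightarrow> y \<in> space M \<Longrightarrow> ((\<lambda>x. f x y) has_real_derivative f' x y) (at x)"
    and bound: "\<And>x y. x \<in> {p<..<q} \<Longrightarrow> y \<in> space M \<Longrightarrow> \<bar>f' x y\<bar> \<le> C"
  shows "((\<lambda>x. \<integral>y. f x y \<partial>M) has_real_derivative (\<integral>y. f' a y \<partial>M)) (at a)"
proof -
  have "((\<lambda>x. ((\<integral>y. f x y \<partial>M) - (\<integral>y. f a y \<partial>M)) / (x - a)) \<longlongrightarrow> (\<integral>y. f' a y \<partial>M)) (at a within {p<..<q})"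
    unfolding tendsto_at_iff_sequentially comp_def
  proof (intro allI impI)
    fix X assume X: "\<forall>i. X i \<in> {p<..<q} - {a}" and lim: "X \<longlonglongrightarrow> a"
    have XS: "X i \<in> {p<..<q}" "X i \<noteq> a" for i using X by auto
    have "(\<lambda>i. \<integral>y. (f (X i) y - f a y) / (X i - a) \<partial>M) \<longlonglongrightarrow> (\<integral>y. f' a y \<partial>M)"
    proof (rule integral_dominated_convergence[where w="\<lambda>_. C"])
      show "(\<lambda>y. (f (X i) y - f a y) / (X i - a)) \<in> borel_measurable M" for i
        using f[OF XS(1)[of i]] f[OF a] by measurable
      show "AE y in M. (\<lambda>i. (f (X i) y - f a y) / (X i - a)) \<longlonglongrightarrow> f' a y"
      proof (rule AE_I2)
        fix y assume "y \<in> space M"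
        from deriv[OF a this] have "((\<lambda>x. (f x y - f a y) / (x - a)) \<longlongrightarrow> f' a y) (at a within UNIV)"
          by (simp add: has_field_derivative_iff)
        then show "(\<lambda>i. (f (X i) y - f a y) / (X i - a)) \<longlonglongrightarrow> f' a y"
          unfolding tendsto_at_iff_sequentially comp_def using XS lim by blast
      qed
      show "AE y in M. norm ((f (X i) y - f a y) / (X i - a)) \<le> C" for i
      proof (rule AE_I2)
        fix y assume y: "y \<in> space M"
        have "norm (f (X i) y - f a y) \<le> C * norm (X i - a)"
          by (rule field_differentiable_bound[of "{p<..<q}" "\<lambda>x. f x y" "\<lambda>x. f' x y"])
            (use deriv y bound XS a in \<open>auto intro: has_field_derivative_at_within\<close>)
        then show "norm ((f (X i) y - f a y) / (X i - a)) \<le> C"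
          using XS(2)[of i] by (simp add: divide_simps)
      qed
    qed (use f' in auto)
    moreover have "(\<integral>y. (f (X i) y - f a y) / (X i - a) \<partial>M)
      = ((\<integral>y. f (X i) y \<partial>M) - (\<integral>y. f a y \<partial>M)) / (X i - a)" for i
      using f[OF XS(1)[of i]] f[OF a] by simp
    ultimately show "(\<lambda>i. ((\<integral>y. f (X i) y \<partial>M) - (\<integral>y. f a y \<partial>M)) / (X i - a)) \<longlonglongrightarrow> (\<integral>y. f' a y \<partial>M)"
      by (simp only:)
  qed
  then show ?thesis
    using a by (simp add: has_field_derivative_iff at_within_open[of a "{p<..<q}"])
qed

lemma continuous_on_entropy_fun_mult:
  assumes "x \<in> {0..1}"
  shows "continuous_on {0..1} (\<lambda>y. entropy_fun (x * y))"
  by (rule continuous_on_compose2[OF continuous_on_entropy_fun])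
    (use assms in \<open>auto intro!: continuous_intros mult_le_one\<close>)

lemma entropy_fun_has_derivative:
  assumes "x \<in> {0<..<1}"
  shows "(entropy_fun has_real_derivative ln (1 - x) - ln x) (at x)"
  unfolding entropy_fun_def[abs_def] using assms
  by (auto intro!: derivative_eq_intros simp: divide_simps)

lemma entropy_fun_bounded:
  obtains C where "\<And>x. x \<in> {0..1} \<Longrightarrow> \<bar>entropy_fun x\<bar> \<le> C"
proof -
  have "compact (entropy_fun ` {0..1})"
    by (intro compact_continuous_image continuous_on_entropy_fun) simp
  then have "bounded (entropy_fun ` {0..1})"
    by (rule compact_imp_bounded)
  then show ?thesis
    using that unfolding bounded_iff by force
qed

lemma mult_less_one:
  fixes x y :: real
  assumes "0 < x" "x < 1" "y \<in> {0..1}"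
  shows "x * y < 1"
proof -
  have "x * y \<le> x"
    using assms by (intro mult_left_le) auto
  then show ?thesis
    using assms by linarith
qed

section \<open>Probability measures on the unit interval and their potentials\<close>

locale unit_interval_prob = prob_space M for M :: "real measure" +
  assumes sets_M [measurable_cong]: "sets M = sets (restrict_space borel {0..1})"
begin

lemma space_M: "space M = {0..1}"
  using sets_eq_imp_space_eq[OF sets_M] by (simp add: space_restrict_space)

lemma borel_measurable_M: "f \<in> borel_measurable borel \<Longrightarrow> f \<in> borel_measurable M"
  using measurable_restrict_space1[of f borel borel "{0..1}"] measurable_cong_sets[OF sets_M refl] by blast

lemma borel_measurable_continuous:
  fixes f :: "real \<Rightarrow> real"
  assumes "continuous_on {0..1} f"
  shows "f \<in> borel_measurable M"
  using borel_measurable_continuous_on_restrict[OF assms] measurable_cong_sets[OF sets_M refl] by blast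

lemma integrable_continuous:
  fixes f :: "real \<Rightarrow> real"
  assumes "continuous_on {0..1} f"
  shows "integrable M f"
proof -
  have "compact (f ` {0..1})"
    by (intro compact_continuous_image assms) simp
  then obtain C where "\<forall>x\<in>{0..1}. norm (f x) \<le> C"
    using compact_imp_bounded bounded_iff by (metis imageI)
  then show ?thesis
    by (intro integrable_const_bound[of _ C] borel_measurable_continuous[OF assms]) (auto simp: space_M)
qed

text \<open>Fubini's theorem, applicable because the integrand is bounded and the product measure is
  finite. The iterated form exposes the inner integral that enters \<open>potential\<close>.\<close>

lemma iterated_integral_eq_product_integral:
  "(\<integral>x. (\<integral>y. entropy_fun (x * y) \<partial>M) \<partial>M) = (\<integral>(x, y). entropy_fun (x * y) \<partial>(M \<Otimes>\<^sub>M M))"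
proof -
  interpret P: pair_prob_space M M ..
  obtain C where C: "\<And>x. x \<in> {0..1} \<Longrightarrow> \<bar>entropy_fun x\<bar> \<le> C"
    using entropy_fun_bounded by blast
  have id [measurable]: "(\<lambda>x. x) \<in> borel_measurable M"
    by (rule borel_measurable_M) simp
  have [measurable]: "(\<lambda>(x, y). entropy_fun (x * y)) \<in> borel_measurable (M \<Otimes>\<^sub>M M)"
    using measurable_compose[OF measurable_fst id] measurable_compose[OF measurable_snd id] by measurable
  have "integrable (M \<Otimes>\<^sub>M M) (\<lambda>(x, y). entropy_fun (x * y))"
    by (rule P.integrable_const_bound[of _ C])
      (auto simp: space_pair_measure space_M intro!: AE_I2 C mult_le_one)
  from P.integral_fst'[OF this] show ?thesis
    by simp
qed

lemma entropy_functional_eq: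
  "entropy_functional M = (\<integral>x. (\<integral>y. entropy_fun (x * y) \<partial>M) \<partial>M) - (\<integral>x. entropy_fun x \<partial>M)"
  unfolding entropy_functional_def iterated_integral_eq_product_integral ..

lemma continuous_on_integral_entropy_fun:
  "continuous_on {0..1} (\<lambda>x. \<integral>y. entropy_fun (x * y) \<partial>M)"
  unfolding continuous_on_sequentially comp_def
proof (intro ballI allI impI, elim conjE)
  fix a X assume a: "a \<in> {0..1}" and X: "\<forall>n. X n \<in> {0..1::real}" and lim: "X \<longlonglongrightarrow> a"
  obtain C where C: "\<And>x. x \<in> {0..1} \<Longrightarrow> \<bar>entropy_fun x\<bar> \<le> C"
    using entropy_fun_bounded by blast
  show "(\<lambda>n. \<integral>y. entropy_fun (X n * y) \<partial>M) \<longlonglongrightarrow> (\<integral>y. entropy_fun (a * y) \<partial>M)"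
  proof (rule integral_dominated_convergence[where w="\<lambda>_. C"])
    show "AE y in M. (\<lambda>n. entropy_fun (X n * y)) \<longlonglongrightarrow> entropy_fun (a * y)"
    proof (rule AE_I2)
      fix y assume "y \<in> space M"
      then have y: "y \<in> {0..1}" by (simp add: space_M)
      have "(\<lambda>n. X n * y) \<longlonglongrightarrow> a * y"
        by (intro tendsto_intros lim)
      then show "(\<lambda>n. entropy_fun (X n * y)) \<longlonglongrightarrow> entropy_fun (a * y)"
        by (intro continuous_on_tendsto_compose[OF continuous_on_entropy_fun])
          (use X y a in \<open>auto intro!: always_eventually mult_le_one\<close>)
    qed
    show "AE y in M. norm (entropy_fun (X n * y)) \<le> C" for n
      using X by (auto intro!: AE_I2 C mult_le_one simp: space_M)
  qed (use X a in \<open>auto intro!: borel_measurable_continuous continuous_on_entropy_fun_mult\<close>)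
qed

text \<open>The set where \<open>f\<close> does not vanish is relatively open and null, so it
  contains no point of the support. This turns almost-everywhere identities into identities on the
  support.\<close>

lemma measure_support_subset_zeros:
  fixes f :: "real \<Rightarrow> real"
  assumes f: "continuous_on {0..1} f" and ae: "AE x in M. f x = 0" and x: "x \<in> measure_support M"
  shows "f x = 0"
proof (rule ccontr)
  assume "f x \<noteq> 0"
  have "open (- {0::real})" by auto
  with f obtain U where U: "open U" "U \<inter> {0..1} = f -` (- {0}) \<inter> {0..1}"
    unfolding continuous_on_open_invariant by blast
  from x have "x \<in> {0..1}" and pos: "\<And>U. open U \<Longrightarrow> x \<in> U \<Longrightarrow> emeasure M (U \<inter> space M) > 0"
    by (auto simp: measure_support_def space_M)
  with U \<open>f x \<noteq> 0\<close> have "x \<in> U" by blast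
  have "emeasure M (U \<inter> space M) = emeasure M {x \<in> space M. f x \<noteq> 0}"
    unfolding space_M U(2) by (intro arg_cong[of _ _ "emeasure M"]) auto
  also have "\<dots> = 0"
    using ae by (intro emeasure_eq_0_AE) simp
  finally show False using pos[OF \<open>open U\<close> \<open>x \<in> U\<close>] by simp
qed

text \<open>The first variation of \<open>entropy_functional\<close> at \<open>M\<close>: moving
  from \<open>M\<close> towards \<open>N\<close> changes the functional at initial rate
  \<open>(\<integral>x. potential x \<partial>N) - (\<integral>x. potential x \<partial>M)\<close>.
  The factor 2 comes from the symmetry of the kernel \<open>entropy_fun (x * y)\<close>.\<close>

definition potential :: "real \<Rightarrow> real" where
  "potential x = 2 * (\<integral>y. entropy_fun (x * y) \<partial>M) - entropy_fun x"

lemma continuous_on_potential: "continuous_on {0..1} potential"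
  unfolding potential_def
  by (intro continuous_on_diff continuous_on_mult_left continuous_on_integral_entropy_fun continuous_on_entropy_fun)

end

section \<open>Point masses and mixtures\<close>

lemma unit_interval_prob_return:
  assumes "x \<in> {0..1}"
  shows "unit_interval_prob (return (restrict_space borel {0..1}) x)"
proof -
  have "x \<in> space (restrict_space borel {0..1})"
    using assms by (simp add: space_restrict_space)
  then show ?thesis
    by (simp add: unit_interval_prob_def unit_interval_prob_axioms_def prob_space_return)
qed

lemma integral_return_continuous:
  fixes f :: "real \<Rightarrow> real"
  assumes "x \<in> {0..1}" "continuous_on {0..1} f"
  shows "(\<integral>y. f y \<partial>return (restrict_space borel {0..1}) x) = f x"
proof (rule integral_return)
  show "x \<in> space (restrict_space borel {0..1})"
    using assms(1) by (simp add: space_restrict_space)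
qed (rule borel_measurable_continuous_on_restrict[OF assms(2)])

text \<open>The convex combination is realized by a biased coin: \<open>N\<close> is sampled with
  probability \<open>t\<close> and \<open>M\<close> otherwise. Continuous integrands are bounded on
  the unit interval, which is what \<open>integral_bind\<close> asks for.\<close>

lemma mixture_exists:
  assumes M: "unit_interval_prob M" and N: "unit_interval_prob N" and t: "t \<in> {0..1}"
  obtains R where "unit_interval_prob R"
    "\<And>f :: real \<Rightarrow> real. continuous_on {0..1} f \<Longrightarrow>
       (\<integral>x. f x \<partial>R) = (1 - t) * (\<integral>x. f x \<partial>M) + t * (\<integral>x. f x \<partial>N)"
proof -
  interpret M: unit_interval_prob M by fact
  interpret N: unit_interval_prob N by fact
  let ?S = "restrict_space borel {0..1::real}"
  define K where "K b = (if b then N else M)" for b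
  define R where "R = measure_pmf (bernoulli_pmf t) \<bind> K"
  have K: "K \<in> measurable (measure_pmf (bernoulli_pmf t)) (subprob_algebra ?S)"
    using M.subprob_space_axioms N.subprob_space_axioms M.sets_M N.sets_M
    by (simp add: K_def space_subprob_algebra)
  have "prob_space R"
    unfolding R_def
    by (rule prob_space.prob_space_bind[OF prob_space_measure_pmf _ K])
      (auto simp: K_def M.prob_space_axioms N.prob_space_axioms)
  moreover have "sets R = sets ?S"
    unfolding R_def by (rule sets_bind_measurable[OF K]) simp
  ultimately have "unit_interval_prob R"
    by (simp add: unit_interval_prob_def unit_interval_prob_axioms_def)
  moreover have "(\<integral>x. f x \<partial>R) = (1 - t) * (\<integral>x. f x \<partial>M) + t * (\<integral>x. f x \<partial>N)"
    if f: "continuous_on {0..1} f" for f :: "real \<Rightarrow> real"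
  proof -
    have "compact (f ` {0..1})"
      by (intro compact_continuous_image f) simp
    then obtain C where C: "\<forall>x\<in>{0..1}. norm (f x) \<le> C"
      using compact_imp_bounded bounded_iff by (metis imageI)
    have "(\<integral>x. f x \<partial>R) = (\<integral>b. (\<integral>x. f x \<partial>K b) \<partial>measure_pmf (bernoulli_pmf t))"
      unfolding R_def
      by (rule integral_bind[OF borel_measurable_continuous_on_restrict[OF f] _ K, where B = C and B' = 1])
        (use C in \<open>auto simp: space_restrict_space K_def M.emeasure_space_1 N.emeasure_space_1
          intro: measure_pmf.finite_measure_axioms\<close>)
    then show ?thesis
      using t by (simp add: K_def)
  qed
  ultimately show thesis by (rule that)
qed

section \<open>Supporting lines and the first-order condition\<close>

text \<open>Every chord over \<open>m\<close> passes on or above the point \<open>(m, v)\<close>.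
  Hence each slope from a point of the graph on the left to \<open>(m, v)\<close> is at most each
  slope from \<open>(m, v)\<close> to a point on the right, and any number in between is the slope
  of a supporting line. Convexity of \<open>g\<close> is not assumed.\<close>

lemma supporting_line_at:
  fixes g :: "real \<Rightarrow> real"
  assumes m: "0 < m" "m < 1"
    and ge: "\<And>p q w. p \<in> {0..1} \<Longrightarrow> q \<in> {0..1} \<Longrightarrow> w \<in> {0..1} \<Longrightarrow> w * p + (1 - w) * q = m \<Longrightarrow>
       v \<le> w * g p + (1 - w) * g q"
  obtains c where "\<And>x. x \<in> {0..1} \<Longrightarrow> v + c * (x - m) \<le> g x"
proof -
  define s where "s p = (v - g p) / (m - p)" for p
  have s_le: "s p \<le> (g q - v) / (q - m)" if "p \<in> {0..<m}" "q \<in> {m<..1}" for p q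
  proof -
    have pos: "0 < m - p" "0 < q - m" "0 < q - p" using that by auto
    have w: "1 - (q - m) / (q - p) = (m - p) / (q - p)"
      using pos by (simp add: field_simps)
    \<comment> \<open>The weights are those for which \<open>p\<close> and \<open>q\<close> have
      barycentre \<open>m\<close>.\<close>
    have "v \<le> (q - m) / (q - p) * g p + (1 - (q - m) / (q - p)) * g q"
    proof (rule ge)
      have "(q - m) / (q - p) * p + (m - p) / (q - p) * q = ((q - m) * p + (m - p) * q) / (q - p)"
        by (simp add: add_divide_distrib)
      also have "(q - m) * p + (m - p) * q = m * (q - p)"
        by (simp add: algebra_simps)
      finally show "(q - m) / (q - p) * p + (1 - (q - m) / (q - p)) * q = m"
        unfolding w using pos by simp
    qed (use that m pos in auto)
    also have "\<dots> = ((q - m) * g p + (m - p) * g q) / (q - p)"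
      unfolding w by (simp add: add_divide_distrib)
    finally have "v * (q - p) \<le> (q - m) * g p + (m - p) * g q"
      using pos by (simp add: field_simps)
    then have "(v - g p) * (q - m) \<le> (g q - v) * (m - p)"
      by (simp add: algebra_simps)
    then show ?thesis
      unfolding s_def using pos by (simp add: field_simps)
  qed
  \<comment> \<open>The set of left slopes is nonempty since \<open>0 < m\<close>, and it is bounded
    by the right slope at 1 since \<open>m < 1\<close>.\<close>
  define c where "c = Sup (s ` {0..<m})"
  have bdd: "bdd_above (s ` {0..<m})"
    using s_le[of _ 1] m by (intro bdd_aboveI2[of _ _ "(g 1 - v) / (1 - m)"]) auto
  have "v + c * (x - m) \<le> g x" if x: "x \<in> {0..1}" for x
  proof (cases x m rule: linorder_cases)
    case less
    then have "s x \<le> c"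
      unfolding c_def using x by (intro cSup_upper bdd) auto
    then show ?thesis
      using less by (simp add: s_def field_simps)
  next
    case equal
    then show ?thesis using ge[of m m 1] m by auto
  next
    case greater
    then have "c \<le> (g x - v) / (x - m)"
      unfolding c_def using x m by (intro cSup_least) (auto intro!: s_le)
    then show ?thesis
      using greater by (simp add: field_simps)
  qed
  then show thesis by (rule that)
qed


context unit_interval_prob
begin

text \<open>Along the segment from \<open>M\<close> to the two-point measure \<open>N\<close> with
  weights \<open>w\<close> at \<open>p\<close> and \<open>1 - w\<close> at \<open>q\<close>, the
  mean is constant and the functional is a quadratic polynomial in \<open>t\<close>. Minimality at
  \<open>t = 0\<close> forces its linear coefficient to be nonnegative.\<close>

lemma integral_potential_le_two_point:
  assumes min: "\<And>R. unit_interval_prob R \<Longrightarrow> (\<integral>x. x \<partial>R) = (\<integral>x. x \<partial>M) \<Longrightarrow>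
      entropy_functional M \<le> entropy_functional R"
    and p: "p \<in> {0..1}" and q: "q \<in> {0..1}" and w: "w \<in> {0..1}"
    and mean: "w * p + (1 - w) * q = (\<integral>x. x \<partial>M)"
  shows "(\<integral>x. potential x \<partial>M) \<le> w * potential p + (1 - w) * potential q"
proof -
  define K where "K x = (\<integral>y. entropy_fun (x * y) \<partial>M)" for x
  define J where "J x = (1 - w) * entropy_fun (x * q) + w * entropy_fun (x * p)" for x
  obtain N where N: "unit_interval_prob N" and
    intN: "\<And>f :: real \<Rightarrow> real. continuous_on {0..1} f \<Longrightarrow> (\<integral>x. f x \<partial>N) = (1 - w) * f q + w * f p"
    using mixture_exists[OF unit_interval_prob_return[OF q] unit_interval_prob_return[OF p] w]
      integral_return_continuous[OF p] integral_return_continuous[OF q] by metis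
  have K: "continuous_on {0..1} K"
    unfolding K_def by (rule continuous_on_integral_entropy_fun)
  have H: "continuous_on {0..1} (\<lambda>x. entropy_fun (x * r))" if "r \<in> {0..1}" for r
    using continuous_on_entropy_fun_mult[OF that] by (simp add: mult.commute)
  have J: "continuous_on {0..1} J"
    unfolding J_def by (intro continuous_on_add continuous_on_mult_left H p q)
  \<comment> \<open>\<open>I\<close>, \<open>A\<close> and \<open>c\<close> are the values of the
    bilinear form with kernel \<open>entropy_fun (x * y)\<close> at the pairs \<open>(M, M)\<close>,
    \<open>(M, N)\<close> and \<open>(N, N)\<close>; \<open>h\<close> and \<open>hN\<close> are the
    linear terms at \<open>M\<close> and \<open>N\<close>.\<close>
  define I where "I = (\<integral>x. K x \<partial>M)"
  define A where "A = (1 - w) * K q + w * K p"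
  define h where "h = (\<integral>x. entropy_fun x \<partial>M)"
  define hN where "hN = (1 - w) * entropy_fun q + w * entropy_fun p"
  define c where "c = (1 - w) * J q + w * J p"
  \<comment> \<open>This is the symmetry of the bilinear form: pairing \<open>N\<close> with
    \<open>M\<close> gives the same value as pairing \<open>M\<close> with \<open>N\<close>.\<close>
  have intJ: "(\<integral>x. J x \<partial>M) = A"
    unfolding J_def A_def K_def
    using integrable_continuous[OF H[OF p]] integrable_continuous[OF H[OF q]]
    by (simp add: mult.commute)
  \<comment> \<open>The right-hand side is the increase of the functional from \<open>M\<close> to
    the mixture with parameter \<open>t\<close>, divided by \<open>t\<close>.\<close>
  have pos: "0 \<le> (2 * A - hN - (2 * I - h)) + t * (I - 2 * A + c)" if t: "0 < t" "t \<le> 1" for t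
  proof -
    obtain R where R: "unit_interval_prob R" and
      intR: "\<And>f :: real \<Rightarrow> real. continuous_on {0..1} f \<Longrightarrow>
        (\<integral>x. f x \<partial>R) = (1 - t) * (\<integral>x. f x \<partial>M) + t * (\<integral>x. f x \<partial>N)"
      using mixture_exists[OF unit_interval_prob_axioms N, of t] t by auto
    interpret R: unit_interval_prob R by fact
    have "(\<integral>x. x \<partial>R) = (\<integral>x. x \<partial>M)"
      using mean by (simp add: intR intN continuous_on_id algebra_simps)
    from min[OF R this] have le: "I - h \<le> entropy_functional R"
      by (simp add: entropy_functional_eq I_def K_def h_def)
    have "(\<integral>x. (\<integral>y. entropy_fun (x * y) \<partial>R) \<partial>R) = (\<integral>x. (1 - t) * K x + t * J x \<partial>R)"
    proof (rule Bochner_Integration.integral_cong[OF refl])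
      fix x assume "x \<in> space R"
      then have "continuous_on {0..1} (\<lambda>y. entropy_fun (x * y))"
        by (intro continuous_on_entropy_fun_mult) (simp add: R.space_M)
      then show "(\<integral>y. entropy_fun (x * y) \<partial>R) = (1 - t) * K x + t * J x"
        by (simp add: intR intN K_def J_def)
    qed
    also have "\<dots> = (1 - t) * (\<integral>x. K x \<partial>R) + t * (\<integral>x. J x \<partial>R)"
      using R.integrable_continuous[OF K] R.integrable_continuous[OF J] by simp
    also have "\<dots> = (1 - t) * ((1 - t) * I + t * A) + t * ((1 - t) * A + t * c)"
      by (simp add: intR intN K J intJ I_def A_def c_def)
    finally have "entropy_functional R
        = (1 - t) * ((1 - t) * I + t * A) + t * ((1 - t) * A + t * c) - ((1 - t) * h + t * hN)"
      by (simp add: R.entropy_functional_eq intR intN continuous_on_entropy_fun h_def hN_def)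
    also have "\<dots> = I - h + t * ((2 * A - hN - (2 * I - h)) + t * (I - 2 * A + c))"
      by (simp add: algebra_simps)
    finally have "0 \<le> t * ((2 * A - hN - (2 * I - h)) + t * (I - 2 * A + c))"
      using le by simp
    then show ?thesis
      using t by (simp add: zero_le_mult_iff)
  qed
  have "0 \<le> 2 * A - hN - (2 * I - h)"
  proof (rule tendsto_lowerbound)
    show "((\<lambda>t. (2 * A - hN - (2 * I - h)) + t * (I - 2 * A + c)) \<longlongrightarrow> 2 * A - hN - (2 * I - h)) (at_right 0)"
      by (auto intro!: tendsto_eq_intros)
    show "\<forall>\<^sub>F t in at_right 0. 0 \<le> (2 * A - hN - (2 * I - h)) + t * (I - 2 * A + c)"
      unfolding eventually_at_right_field by (intro exI[of _ 1]) (auto intro: pos)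
  qed simp
  moreover have "(\<integral>x. potential x \<partial>M) = 2 * I - h"
    unfolding potential_def I_def K_def h_def
    using integrable_continuous[OF continuous_on_integral_entropy_fun]
      integrable_continuous[OF continuous_on_entropy_fun] by simp
  moreover have "w * potential p + (1 - w) * potential q = 2 * A - hN"
    by (simp add: potential_def A_def K_def hN_def algebra_simps)
  ultimately show ?thesis by simp
qed

text \<open>The line through \<open>(m, v)\<close> integrates to \<open>v\<close>, because
  \<open>m\<close> is the mean of \<open>M\<close>, and \<open>v\<close> is also the integral of the
  potential. The gap is therefore nonnegative with integral 0, so it vanishes almost
  everywhere.\<close>

lemma minimizer_supporting_line:
  assumes min: "\<And>R. unit_interval_prob R \<Longrightarrow> (\<integral>x. x \<partial>R) = (\<integral>x. x \<partial>M) \<Longrightarrow>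
      entropy_functional M \<le> entropy_functional R"
    and m: "0 < (\<integral>x. x \<partial>M)" "(\<integral>x. x \<partial>M) < 1"
  obtains c d where "\<And>x. x \<in> {0..1} \<Longrightarrow> 0 \<le> potential x - (c * x + d)"
    and "AE x in M. potential x - (c * x + d) = 0"
proof -
  define m where "m = (\<integral>x. x \<partial>M)"
  define v where "v = (\<integral>x. potential x \<partial>M)"
  obtain c where c: "\<And>x. x \<in> {0..1} \<Longrightarrow> v + c * (x - m) \<le> potential x"
    using supporting_line_at[of m v potential] integral_potential_le_two_point[OF min] m
    unfolding m_def v_def by metis
  define d where "d = v - c * m"
  have nonneg: "0 \<le> potential x - (c * x + d)" if "x \<in> {0..1}" for x
    using c[OF that] by (simp add: d_def algebra_simps)
  have cont: "continuous_on {0..1} (\<lambda>x. potential x - (c * x + d))"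
    by (intro continuous_on_diff continuous_on_potential continuous_intros)
  have "(\<integral>x. potential x - (c * x + d) \<partial>M) = 0"
    using integrable_continuous[OF continuous_on_potential] integrable_continuous[OF continuous_on_id]
    by (simp add: d_def v_def m_def prob_space)
  then have "AE x in M. potential x - (c * x + d) = 0"
    using nonneg by (subst integral_nonneg_eq_0_iff_AE[symmetric, OF integrable_continuous[OF cont]])
      (auto simp: space_M)
  with nonneg show thesis by (rule that)
qed

section \<open>Derivatives of the potential and monotone curvature\<close>

text \<open>At \<open>y = 0\<close> the leading factor makes the integrand 0, whatever value
  \<open>ln 0\<close> has.\<close>

definition potential' :: "real \<Rightarrow> real" where
  "potential' x = 2 * (\<integral>y. y * (ln (1 - x * y) - ln (x * y)) \<partial>M) - (ln (1 - x) - ln x)"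

text \<open>The second derivative of the potential multiplied by the positive weight
  \<open>x * (1 - x)\<close>: the sign is kept, and monotonicity can be read off the
  integrand.\<close>

definition curvature :: "real \<Rightarrow> real" where
  "curvature x = 1 - 2 * (\<integral>y. y * (1 - x) / (1 - x * y) \<partial>M)"

lemma integrable_curvature:
  assumes "x \<in> {0<..<1}"
  shows "integrable M (\<lambda>y. y * (1 - x) / (1 - x * y))"
proof (rule integrable_continuous)
  have "x * y < 1" if "y \<in> {0..1}" for y
    using assms that by (simp add: mult_less_one)
  then show "continuous_on {0..1} (\<lambda>y. y * (1 - x) / (1 - x * y))"
    by (intro continuous_intros) fastforce
qed

text \<open>Differentiation under the integral. For \<open>x\<close> between \<open>p\<close> and
  \<open>q\<close>, \<open>x * y\<close> stays below \<open>q < 1\<close>, which controls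
  \<open>ln (1 - x * y)\<close>; the singularity of \<open>ln (x * y)\<close> at
  \<open>y = 0\<close> is tamed by the factor \<open>y\<close>.\<close>

lemma potential_has_derivative:
  assumes a: "a \<in> {0<..<1}"
  shows "(potential has_real_derivative potential' a) (at a)"
proof -
  define p q where "p = a / 2" and "q = (1 + a) / 2"
  have pq: "0 < p" "p < a" "a < q" "q < 1" using a by (auto simp: p_def q_def)
  have "((\<lambda>x. \<integral>y. entropy_fun (x * y) \<partial>M) has_real_derivative
      (\<integral>y. y * (ln (1 - a * y) - ln (a * y)) \<partial>M)) (at a)"
  proof (rule has_real_derivative_lebesgue_integral
      [where f' = "\<lambda>x y. y * (ln (1 - x * y) - ln (x * y))" and p = p and q = q and C = "- ln (1 - q) - ln p + 1"])
    show "a \<in> {p<..<q}" using pq by simp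
    show "integrable M (\<lambda>y. entropy_fun (x * y))" if "x \<in> {p<..<q}" for x
      using that pq by (intro integrable_continuous continuous_on_entropy_fun_mult) auto
    show "(\<lambda>y. y * (ln (1 - a * y) - ln (a * y))) \<in> borel_measurable M"
      by (rule borel_measurable_M) measurable
    fix x y assume x: "x \<in> {p<..<q}" and "y \<in> space M"
    then have y: "0 \<le> y" "y \<le> 1" by (auto simp: space_M)
    have x1: "0 < x" "x < 1" using x pq by auto
    have xy: "x * y \<le> x" using x1 y by (simp add: mult_left_le)
    show "((\<lambda>x. entropy_fun (x * y)) has_real_derivative y * (ln (1 - x * y) - ln (x * y))) (at x)"
    proof (cases "y = 0")
      case True
      then show ?thesis by simp
    next
      case False
      then have "x * y \<in> {0<..<1}" using x1 y by (auto simp: mult_less_one)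
      note entropy_fun_has_derivative[OF this]
      moreover have "((\<lambda>x. x * y) has_real_derivative y) (at x)"
        by (auto intro!: derivative_eq_intros)
      ultimately have "((\<lambda>x. entropy_fun (x * y)) has_real_derivative
          (ln (1 - x * y) - ln (x * y)) * y) (at x)"
        by (rule DERIV_chain2)
      then show ?thesis
        by (simp only: mult.commute[of y])
    qed
    have "\<bar>y * ln (1 - x * y)\<bar> \<le> - ln (1 - q)"
    proof -
      have "x * y \<le> q" by (rule order.trans[OF xy]) (use x in simp)
      then have "1 - q \<le> 1 - x * y" "1 - x * y \<le> 1" using x1 y by auto
      then have "ln (1 - q) \<le> ln (1 - x * y)" "ln (1 - x * y) \<le> 0"
        using pq by auto
      moreover have "y * (- ln (1 - x * y)) \<le> 1 * (- ln (1 - x * y))"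
        using calculation y by (intro mult_right_mono) auto
      moreover have "0 \<le> y * (- ln (1 - x * y))"
        using calculation y by (intro mult_nonneg_nonneg) auto
      ultimately show ?thesis by (simp add: abs_if)
    qed
    moreover have "\<bar>y * ln (x * y)\<bar> \<le> - ln p + 1"
    proof (cases "y = 0")
      case True
      moreover have "ln p \<le> 0" using pq by simp
      ultimately show ?thesis by simp
    next
      case False
      then have y0: "0 < y" using y by simp
      \<comment> \<open>Multiplied by \<open>y\<close>, this yields
        \<open>- y * ln y \<le> 1 - y\<close>, a bound uniform in \<open>y\<close>.\<close>
      have "ln (1 / y) \<le> 1 / y - 1" by (rule ln_le_minus_one) (use y0 in simp)
      then have "- ln y \<le> 1 / y - 1" using y0 by (simp add: ln_div)
      then have "y * (- ln y) \<le> y * (1 / y - 1)" using y0 by (intro mult_left_mono) auto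
      also have "\<dots> \<le> 1" using y0 by (simp add: algebra_simps)
      finally have 1: "y * (- ln y) \<le> 1" .
      have "ln p \<le> ln x" "ln x \<le> 0" using x pq x1 by auto
      then have 2: "y * (- ln x) \<le> - ln p" "0 \<le> y * (- ln x)"
        using y mult_right_mono[of y 1 "- ln x"] mult_nonneg_nonneg[of y "- ln x"] by auto
      have 3: "0 \<le> y * (- ln y)" using y y0 by (intro mult_nonneg_nonneg) auto
      have "y * ln (x * y) = - (y * (- ln x)) - y * (- ln y)"
        using x1 y0 by (simp add: ln_mult algebra_simps)
      with 1 2 3 show ?thesis by linarith
    qed
    ultimately show "\<bar>y * (ln (1 - x * y) - ln (x * y))\<bar> \<le> - ln (1 - q) - ln p + 1"
      unfolding right_diff_distrib by linarith
  qed
  moreover have "(entropy_fun has_real_derivative ln (1 - a) - ln a) (at a)"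
    by (rule entropy_fun_has_derivative[OF a])
  ultimately show ?thesis
    unfolding potential_def[abs_def] potential'_def by (intro DERIV_diff DERIV_cmult)
qed

text \<open>The derivative of the integrand collapses to \<open>- y / (x * (1 - x * y))\<close>,
  which has no singularity at \<open>y = 0\<close> and is bounded for \<open>x\<close> between
  \<open>p\<close> and \<open>q\<close>.\<close>

lemma potential'_has_derivative:
  assumes a: "a \<in> {0<..<1}"
  shows "(potential' has_real_derivative curvature a / (a * (1 - a))) (at a)"
proof -
  define p q where "p = a / 2" and "q = (1 + a) / 2"
  have pq: "0 < p" "p < a" "a < q" "q < 1" using a by (auto simp: p_def q_def)
  have *: "((\<lambda>x. \<integral>y. y * (ln (1 - x * y) - ln (x * y)) \<partial>M) has_real_derivative
      (\<integral>y. - y / (a * (1 - a * y)) \<partial>M)) (at a)"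
  proof (rule has_real_derivative_lebesgue_integral
      [where f' = "\<lambda>x y. - y / (x * (1 - x * y))" and p = p and q = q and C = "1 / (p * (1 - q))"])
    show "a \<in> {p<..<q}" using pq by simp
    show "(\<lambda>y. - y / (a * (1 - a * y))) \<in> borel_measurable M"
      by (rule borel_measurable_M) measurable
    show "integrable M (\<lambda>y. y * (ln (1 - x * y) - ln (x * y)))" if "x \<in> {p<..<q}" for x
    proof (rule integrable_continuous)
      have x1: "0 < x" "x < 1" using that pq by auto
      have xy: "x * y < 1" if "y \<in> {0..1}" for y
        using x1 that by (rule mult_less_one)
      have ne: "1 - x * y \<noteq> 0" if "y \<in> {0..1}" for y
        using xy[OF that] by simp
      have "continuous_on {0..1} (\<lambda>y. x * y * ln (x * y))"
        by (rule continuous_on_compose2[OF continuous_on_x_ln_x])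
          (use x1 in \<open>auto intro!: continuous_intros\<close>)
      \<comment> \<open>Continuity at \<open>y = 0\<close> comes from that of \<open>t * ln t\<close>, hence the division by \<open>x\<close>.\<close>
      then have "continuous_on {0..1} (\<lambda>y. (x * y * ln (x * y)) / x)"
        using x1 by (intro continuous_on_divide continuous_on_const) auto
      moreover have "continuous_on {0..1} (\<lambda>y. y * ln (1 - x * y))"
        using ne by (intro continuous_intros ballI)
      ultimately have "continuous_on {0..1} (\<lambda>y. y * ln (1 - x * y) - (x * y * ln (x * y)) / x)"
        by (intro continuous_on_diff)
      then show "continuous_on {0..1} (\<lambda>y. y * (ln (1 - x * y) - ln (x * y)))"
        using x1 by (simp add: right_diff_distrib)
    qed
    fix x y assume x: "x \<in> {p<..<q}" and "y \<in> space M"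
    then have y: "0 \<le> y" "y \<le> 1" by (auto simp: space_M)
    have x1: "0 < x" "x < 1" using x pq by auto
    have xy: "x * y \<le> x" using x1 y by (simp add: mult_left_le)
    show "((\<lambda>x. y * (ln (1 - x * y) - ln (x * y))) has_real_derivative - y / (x * (1 - x * y))) (at x)"
    proof (cases "y = 0")
      case True
      then show ?thesis by simp
    next
      case False
      have pos: "0 < x * y" "0 < 1 - x * y" "y > 0" using False x1 y by (auto simp: mult_less_one)
      have "y * (- y / (1 - x * y) - y / (x * y)) = - y / (x * (1 - x * y))"
        using pos x1 by (simp add: divide_simps)
      moreover have "((\<lambda>x. y * (ln (1 - x * y) - ln (x * y))) has_real_derivative
          y * (- y / (1 - x * y) - y / (x * y))) (at x)"
        using pos by (auto intro!: derivative_eq_intros)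
      ultimately show ?thesis by simp
    qed
    have "x * y \<le> q" by (rule order.trans[OF xy]) (use x in simp)
    then have "p * (1 - q) \<le> x * (1 - x * y)"
      using x pq x1 by (intro mult_mono) auto
    then have "y / (x * (1 - x * y)) \<le> 1 / (p * (1 - q))"
      using y pq by (intro frac_le) auto
    moreover have "0 \<le> y / (x * (1 - x * y))"
      using y x1 mult_less_one[of x y] by (intro divide_nonneg_nonneg mult_nonneg_nonneg) auto
    ultimately show "\<bar>- y / (x * (1 - x * y))\<bar> \<le> 1 / (p * (1 - q))"
      unfolding minus_divide_left[symmetric] abs_minus_cancel by linarith
  qed
  have "((\<lambda>x. ln (1 - x) - ln x) has_real_derivative - 1 / (1 - a) - 1 / a) (at a)"
    using a by (auto intro!: derivative_eq_intros)
  from DERIV_diff[OF DERIV_cmult[OF *, of 2] this]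
  have D: "(potential' has_real_derivative
      2 * (\<integral>y. - y / (a * (1 - a * y)) \<partial>M) - (- 1 / (1 - a) - 1 / a)) (at a)"
    by (simp add: potential'_def[abs_def])
  \<comment> \<open>The factor \<open>1 / (a * (1 - a))\<close> is extracted so that the integrand
    of \<open>curvature\<close> remains.\<close>
  have "(\<integral>y. - y / (a * (1 - a * y)) \<partial>M) = (\<integral>y. (- 1 / (a * (1 - a))) * (y * (1 - a) / (1 - a * y)) \<partial>M)"
    using a by (intro Bochner_Integration.integral_cong refl) simp
  also have "\<dots> = (- 1 / (a * (1 - a))) * (\<integral>y. y * (1 - a) / (1 - a * y) \<partial>M)"
    by (rule integral_mult_right_zero)
  finally have "2 * (\<integral>y. - y / (a * (1 - a * y)) \<partial>M) - (- 1 / (1 - a) - 1 / a) = curvature a / (a * (1 - a))"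
    using a by (simp add: curvature_def) (simp add: field_simps)
  with D show ?thesis by simp
qed

text \<open>For fixed \<open>y\<close> strictly between 0 and 1 the integrand strictly decreases in
  \<open>x\<close>, while for \<open>y = 0\<close> and \<open>y = 1\<close> it is constantly 0 and
  1. The hypothesis \<open>nd\<close> gives positive mass to the strict case.\<close>

lemma curvature_strict_mono:
  assumes nd: "\<not> (AE y in M. y = 0 \<or> y = 1)" and x: "0 < x" "x < z" "z < 1"
  shows "curvature x < curvature z"
proof -
  have eq: "y * (1 - x) / (1 - x * y) - y * (1 - z) / (1 - z * y)
      = y * (1 - y) * (z - x) / ((1 - x * y) * (1 - z * y))"
    and pos: "0 < 1 - x * y" "0 < 1 - z * y" if y: "y \<in> {0..1}" for y
  proof -
    show pos: "0 < 1 - x * y" "0 < 1 - z * y"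
      using x y by (auto simp: mult_less_one)
    then show "y * (1 - x) / (1 - x * y) - y * (1 - z) / (1 - z * y)
      = y * (1 - y) * (z - x) / ((1 - x * y) * (1 - z * y))"
      by (simp add: divide_simps) (simp add: algebra_simps)
  qed
  have "(\<integral>y. y * (1 - z) / (1 - z * y) \<partial>M) < (\<integral>y. y * (1 - x) / (1 - x * y) \<partial>M)"
  proof (rule integral_less_AE[where A = "{y \<in> space M. \<not> (y = 0 \<or> y = 1)}"])
    have id [measurable]: "(\<lambda>x. x) \<in> borel_measurable M"
      by (rule borel_measurable_M) simp
    show meas: "{y \<in> space M. \<not> (y = 0 \<or> y = 1)} \<in> sets M"
      by measurable
    show "emeasure M {y \<in> space M. \<not> (y = 0 \<or> y = 1)} \<noteq> 0"
      using nd AE_iff_measurable[OF meas, of "\<lambda>y. y = 0 \<or> y = 1"] by auto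
    show "AE y in M. y * (1 - z) / (1 - z * y) \<le> y * (1 - x) / (1 - x * y)"
    proof (rule AE_I2)
      fix y assume "y \<in> space M"
      then have y: "y \<in> {0..1}" by (simp add: space_M)
      have "0 \<le> y * (1 - y) * (z - x) / ((1 - x * y) * (1 - z * y))"
        using pos[OF y] y x by (intro divide_nonneg_pos mult_nonneg_nonneg mult_pos_pos) auto
      with eq[OF y] show "y * (1 - z) / (1 - z * y) \<le> y * (1 - x) / (1 - x * y)"
        by linarith
    qed
    show "AE y in M. y \<in> {y \<in> space M. \<not> (y = 0 \<or> y = 1)} \<longrightarrow>
        y * (1 - z) / (1 - z * y) \<noteq> y * (1 - x) / (1 - x * y)"
    proof (rule AE_I2, intro impI)
      fix y assume "y \<in> {y \<in> space M. \<not> (y = 0 \<or> y = 1)}"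
      then have y: "y \<in> {0..1}" "0 < y" "y < 1" by (auto simp: space_M)
      have "0 < y * (1 - y) * (z - x) / ((1 - x * y) * (1 - z * y))"
        using pos[OF y(1)] y x by (intro divide_pos_pos mult_pos_pos) auto
      with eq[OF y(1)] show "y * (1 - z) / (1 - z * y) \<noteq> y * (1 - x) / (1 - x * y)"
        by linarith
    qed
  qed (use x in \<open>auto intro!: integrable_curvature\<close>)
  then show ?thesis
    by (simp add: curvature_def)
qed

text \<open>The gap \<open>D\<close> has an interior minimum at \<open>a\<close>, so
  \<open>D'\<close> vanishes there and the curvature is nonnegative. Strict monotonicity makes the
  curvature positive beyond \<open>a\<close>, hence \<open>D'\<close> and then \<open>D\<close>
  increase strictly. The endpoint \<open>b = 1\<close> is covered, since only continuity of
  \<open>D\<close> is used there.\<close>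

lemma potential_minus_line_pos:
  assumes nd: "\<not> (AE y in M. y = 0 \<or> y = 1)"
    and nonneg: "\<And>x. x \<in> {0..1} \<Longrightarrow> 0 \<le> potential x - (c * x + d)"
    and a: "0 < a" "a < b" "b \<le> 1" and zero: "potential a - (c * a + d) = 0"
  shows "0 < potential b - (c * b + d)"
proof -
  define D where "D x = potential x - (c * x + d)" for x
  define D' where "D' x = potential' x - c" for x
  have deriv: "(D has_real_derivative D' x) (at x)" if "x \<in> {0<..<1}" for x
    unfolding D_def[abs_def] D'_def
    by (auto intro!: derivative_eq_intros potential_has_derivative[OF that])
  have deriv': "(D' has_real_derivative curvature x / (x * (1 - x))) (at x)" if "x \<in> {0<..<1}" for x
    unfolding D'_def[abs_def]
    by (auto intro!: derivative_eq_intros potential'_has_derivative[OF that])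
  have cont: "continuous_on {0..1} D"
    unfolding D_def[abs_def] by (intro continuous_on_diff continuous_on_potential continuous_intros)
  have a1: "a \<in> {0<..<1}" using a by auto
  have D'a: "D' a = 0"
  proof (rule DERIV_local_min[OF deriv[OF a1]])
    show "0 < min a (1 - a)" using a1 by auto
    show "\<forall>y. \<bar>a - y\<bar> < min a (1 - a) \<longrightarrow> D a \<le> D y"
      using zero nonneg by (auto simp: D_def abs_less_iff)
  qed
  \<comment> \<open>Second-order condition: a negative second derivative would make
    \<open>D'\<close> negative just to the right of \<open>a\<close>, and \<open>D\<close> would
    drop below its minimum 0.\<close>
  have "0 \<le> curvature a / (a * (1 - a))"
  proof (rule ccontr)
    assume "\<not> ?thesis"
    then obtain e where e: "e > 0" "\<And>h. h > 0 \<Longrightarrow> h < e \<Longrightarrow> D' (a + h) < D' a"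
      using DERIV_neg_dec_right[OF deriv'[OF a1]] by auto
    define z where "z = a + min e (b - a) / 2"
    have z: "a < z" "z < a + e" "z < b" using e a by (auto simp: z_def min_def field_simps)
    have "D z < D a"
    proof (rule DERIV_neg_imp_decreasing_open[OF z(1)])
      fix x assume x: "a < x" "x < z"
      then have "D' x < 0" using e(2)[of "x - a"] z D'a by auto
      then show "\<exists>y. (D has_real_derivative y) (at x) \<and> y < 0"
        using deriv[of x] x z a by auto
    next
      show "continuous_on {a..z} D"
        using a z by (intro continuous_on_subset[OF cont]) auto
    qed
    then show False using zero nonneg[of z] z a by (simp add: D_def)
  qed
  moreover have "0 < a * (1 - a)" using a1 by simp
  ultimately have "0 \<le> curvature a" unfolding zero_le_divide_iff by linarith
  then have curv: "0 < curvature x / (x * (1 - x))" if "a < x" "x < 1" for x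
    using curvature_strict_mono[OF nd a(1) that] that a by simp
  have D'_pos: "0 < D' x" if x: "a < x" "x < 1" for x
  proof -
    have "D' a < D' x"
    proof (rule DERIV_pos_imp_increasing_open[OF x(1)])
      show "\<exists>y. (D' has_real_derivative y) (at z) \<and> 0 < y" if "a < z" "z < x" for z
        using deriv'[of z] curv[of z] that x a by auto
      show "continuous_on {a..x} D'"
        by (intro DERIV_atLeastAtMost_imp_continuous_on exI, rule deriv') (use a x in auto)
    qed
    then show ?thesis using D'a by simp
  qed
  have "D a < D b"
  proof (rule DERIV_pos_imp_increasing_open[OF a(2)])
    show "\<exists>y. (D has_real_derivative y) (at z) \<and> 0 < y" if "a < z" "z < b" for z
      using deriv[of z] D'_pos[of z] that a by auto
    show "continuous_on {a..b} D"
      using a by (intro continuous_on_subset[OF cont]) auto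
  qed
  then show ?thesis using zero by (simp add: D_def)
qed

end


section \<open>Compactness and existence of a minimizer\<close>

lemma mean_measures_iff:
  "\<mu> \<in> mean_measures \<phi> \<longleftrightarrow> unit_interval_prob \<mu> \<and> (\<integral>x. x \<partial>\<mu>) = \<phi>"
  by (auto simp: mean_measures_def unit_interval_prob_def unit_interval_prob_axioms_def)

text \<open>Measures on a bounded interval are tight, so a subsequence converges weakly. In the
  double integral both the outer measure and the inner integral vary with \<open>n\<close>;
  pointwise convergent representatives allow dominated convergence to be applied twice.\<close>

lemma unit_interval_prob_convergent_subsequence:
  assumes \<mu>: "\<And>n::nat. unit_interval_prob (\<mu> n)"
  obtains r M where "strict_mono r" "unit_interval_prob M"
    "(\<lambda>n. \<integral>x. x \<partial>\<mu> (r n)) \<longlonglongrightarrow> (\<integral>x. x \<partial>M)"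
    "(\<lambda>n. entropy_functional (\<mu> (r n))) \<longlonglongrightarrow> entropy_functional M"
proof -
  interpret \<mu>: unit_interval_prob "\<mu> n" for n by (rule \<mu>)
  \<comment> \<open>The measures are transported to the Borel sets of the whole line, the setting of
    \<open>tight\<close> and \<open>Skorohod\<close>.\<close>
  define \<nu> where "\<nu> n = distr (\<mu> n) borel (\<lambda>x. x)" for n
  have id: "(\<lambda>x. x) \<in> borel_measurable (\<mu> n)" for n
    by (rule \<mu>.borel_measurable_M) simp
  have \<nu>: "real_distribution (\<nu> n)" for n
    unfolding \<nu>_def by (rule \<mu>.real_distribution_distr[OF id])
  have "tight \<nu>"
    unfolding tight_def
  proof (intro conjI allI impI \<nu>)
    fix e :: real assume "0 < e"
    \<comment> \<open>Tightness is stated with intervals open on the left; starting at -1 keeps a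
      possible atom at 0 inside.\<close>
    have "measure (\<nu> n) {-1<..1} = 1" for n
    proof -
      have "measure (\<nu> n) {-1<..1} = measure (\<mu> n) ({-1<..1} \<inter> space (\<mu> n))"
        unfolding \<nu>_def by (subst measure_distr[OF id]) (auto simp: vimage_def Int_def)
      also have "{-1<..1} \<inter> space (\<mu> n) = space (\<mu> n)"
        by (auto simp: \<mu>.space_M)
      finally show ?thesis by (simp add: \<mu>.prob_space)
    qed
    then show "\<exists>a b. a < b \<and> (\<forall>n. 1 - e < measure (\<nu> n) {a<..b})"
      using \<open>0 < e\<close> by (intro exI[of _ "-1"] exI[of _ 1]) simp
  qed
  from tight_imp_convergent_subsubsequence[OF this strict_mono_id]
  obtain r M0 where r: "strict_mono r" and M0: "real_distribution M0"
    and weak: "weak_conv_m (\<lambda>n. \<nu> (r n)) M0"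
    by (auto simp: comp_def)
  from Skorohod[OF \<nu> M0 weak] obtain \<Omega> :: "real measure" and Ys Y where
    \<Omega>: "prob_space \<Omega>" and Ys [measurable]: "\<And>n. Ys n \<in> borel_measurable \<Omega>"
    and distr: "\<And>n. distr \<Omega> borel (Ys n) = \<nu> (r n)"
    and Y: "Y \<in> measurable \<Omega> lborel"
    and lim: "\<And>\<omega>. \<omega> \<in> space \<Omega> \<Longrightarrow> (\<lambda>n. Ys n \<omega>) \<longlonglongrightarrow> Y \<omega>"
    by blast
  interpret \<Omega>: prob_space \<Omega> by fact
  have [measurable]: "Y \<in> borel_measurable \<Omega>" using Y by simp
  \<comment> \<open>The variables of Skorohod's theorem lie in the unit interval only almost surely.\<close>
  define clamp where "clamp x = max 0 (min 1 x)" for x :: real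
  have clamp01: "clamp x \<in> {0..1}" for x by (auto simp: clamp_def)
  have clamp_id: "x \<in> {0..1} \<Longrightarrow> clamp x = x" for x by (auto simp: clamp_def)
  have clamp_cont: "continuous_on UNIV clamp"
    unfolding clamp_def[abs_def] by (intro continuous_intros)
  define Zs where "Zs n \<omega> = clamp (Ys n \<omega>)" for n \<omega>
  define Z where "Z \<omega> = clamp (Y \<omega>)" for \<omega>
  have Z01: "Zs n \<omega> \<in> {0..1}" "Z \<omega> \<in> {0..1}" for n \<omega>
    by (simp_all only: Zs_def Z_def clamp01)
  have limZ: "(\<lambda>n. Zs n \<omega>) \<longlonglongrightarrow> Z \<omega>" if "\<omega> \<in> space \<Omega>" for \<omega>
    unfolding Zs_def Z_def clamp_def by (intro tendsto_intros lim that)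
  have Z_meas: "Z \<in> measurable \<Omega> (restrict_space borel {0..1})"
    by (rule measurable_restrict_space2) (use Z01 in \<open>auto simp: Z_def[abs_def] clamp_def\<close>)
  define M where "M = distr \<Omega> (restrict_space borel {0..1}) Z"
  have M: "unit_interval_prob M"
    by (simp add: unit_interval_prob_def unit_interval_prob_axioms_def M_def \<Omega>.prob_space_distr Z_meas)
  interpret M: unit_interval_prob M by fact
  have intM: "(\<integral>x. f x \<partial>M) = (\<integral>\<omega>. f (Z \<omega>) \<partial>\<Omega>)" if "continuous_on {0..1} f" for f :: "real \<Rightarrow> real"
    unfolding M_def by (rule integral_distr[OF Z_meas borel_measurable_continuous_on_restrict[OF that]])
  \<comment> \<open>Composition with \<open>clamp\<close> extends \<open>f\<close> from the unit
    interval to a Borel function on the line.\<close>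
  have clamp_meas: "(\<lambda>x. f (clamp x)) \<in> borel_measurable borel" if "continuous_on {0..1} f" for f :: "real \<Rightarrow> real"
    by (rule borel_measurable_continuous_onI, rule continuous_on_compose2[OF that clamp_cont]) (use clamp01 in auto)
  have int\<mu>: "(\<integral>x. f x \<partial>\<mu> (r n)) = (\<integral>\<omega>. f (Zs n \<omega>) \<partial>\<Omega>)" if "continuous_on {0..1} f" for f :: "real \<Rightarrow> real" and n
  proof -
    have "(\<integral>x. f x \<partial>\<mu> (r n)) = (\<integral>x. f (clamp x) \<partial>\<mu> (r n))"
      by (rule Bochner_Integration.integral_cong) (auto simp: \<mu>.space_M clamp_id)
    also have "\<dots> = (\<integral>x. f (clamp x) \<partial>\<nu> (r n))"
      unfolding \<nu>_def by (rule integral_distr[OF id clamp_meas[OF that], symmetric])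
    also have "\<dots> = (\<integral>\<omega>. f (Zs n \<omega>) \<partial>\<Omega>)"
      unfolding distr[symmetric] Zs_def by (rule integral_distr[OF Ys clamp_meas[OF that]])
    finally show ?thesis .
  qed
  have Zs_comp_meas: "(\<lambda>\<omega>. f (Zs n \<omega>)) \<in> borel_measurable \<Omega>"
    if "continuous_on {0..1} f" for f :: "real \<Rightarrow> real" and n
    unfolding Zs_def by (rule measurable_compose[OF Ys clamp_meas[OF that]])
  have Z_comp_meas: "(\<lambda>\<omega>. f (Z \<omega>)) \<in> borel_measurable \<Omega>"
    if "continuous_on {0..1} f" for f :: "real \<Rightarrow> real"
    using measurable_compose[OF Z_meas borel_measurable_continuous_on_restrict[OF that]] .
  obtain C where C: "\<And>x. x \<in> {0..1} \<Longrightarrow> \<bar>entropy_fun x\<bar> \<le> C"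
    using entropy_fun_bounded by blast
  \<comment> \<open>The integrand \<open>g n\<close> may itself depend on \<open>n\<close>, as the
    inner integrals \<open>K (\<mu> (r n))\<close> do.\<close>
  have lim_int: "(\<lambda>n. \<integral>\<omega>. g n (Zs n \<omega>) \<partial>\<Omega>) \<longlonglongrightarrow> (\<integral>\<omega>. h (Z \<omega>) \<partial>\<Omega>)"
    if g: "\<And>n. continuous_on {0..1} (g n)" and h: "continuous_on {0..1} h"
      and bound: "\<And>n x. x \<in> {0..1} \<Longrightarrow> \<bar>g n x\<bar> \<le> B"
      and conv: "\<And>\<omega>. \<omega> \<in> space \<Omega> \<Longrightarrow> (\<lambda>n. g n (Zs n \<omega>)) \<longlonglongrightarrow> h (Z \<omega>)"
    for g :: "nat \<Rightarrow> real \<Rightarrow> real" and h B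
    by (rule integral_dominated_convergence[where w = "\<lambda>_. B"])
      (use Zs_comp_meas[OF g] Z_comp_meas[OF h] bound[OF Z01(1)] conv in auto)
  have H_lim: "(\<lambda>n. entropy_fun (X n)) \<longlonglongrightarrow> entropy_fun x"
    if "X \<longlonglongrightarrow> x" "\<And>n. X n \<in> {0..1}" "x \<in> {0..1}" for X x
    by (rule continuous_on_tendsto_compose[OF continuous_on_entropy_fun]) (use that in auto)
  have prod01: "x * y \<in> {0..1}" if "x \<in> {0..1}" "y \<in> {0..1}" for x y :: real
    using that by (auto intro: mult_le_one)
  have "(\<lambda>n. \<integral>\<omega>. Zs n \<omega> \<partial>\<Omega>) \<longlonglongrightarrow> (\<integral>\<omega>. Z \<omega> \<partial>\<Omega>)"
    by (rule lim_int[of _ _ 1]) (auto intro: limZ continuous_on_id)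
  then have mean_lim: "(\<lambda>n. \<integral>x. x \<partial>\<mu> (r n)) \<longlonglongrightarrow> (\<integral>x. x \<partial>M)"
    by (simp add: int\<mu> intM continuous_on_id)
  have "(\<lambda>n. \<integral>\<omega>. entropy_fun (Zs n \<omega>) \<partial>\<Omega>) \<longlonglongrightarrow> (\<integral>\<omega>. entropy_fun (Z \<omega>) \<partial>\<Omega>)"
    by (rule lim_int[of _ _ C]) (auto intro!: C H_lim limZ continuous_on_entropy_fun Z01)
  then have ent_lim: "(\<lambda>n. \<integral>x. entropy_fun x \<partial>\<mu> (r n)) \<longlonglongrightarrow> (\<integral>x. entropy_fun x \<partial>M)"
    by (simp add: int\<mu> intM continuous_on_entropy_fun)
  define K where "K N x = (\<integral>y. entropy_fun (x * y) \<partial>N)" for N x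
  have K_cont\<mu>: "continuous_on {0..1} (K (\<mu> (r n)))" for n
    unfolding K_def by (rule \<mu>.continuous_on_integral_entropy_fun)
  have K_contM: "continuous_on {0..1} (K M)"
    unfolding K_def by (rule M.continuous_on_integral_entropy_fun)
  have K_bound: "\<bar>K (\<mu> (r n)) x\<bar> \<le> C" if x: "x \<in> {0..1}" for n x
  proof -
    have "\<bar>K (\<mu> (r n)) x\<bar> \<le> (\<integral>y. \<bar>entropy_fun (x * y)\<bar> \<partial>\<mu> (r n))"
      unfolding K_def by (rule integral_abs_bound)
    also have "\<dots> \<le> (\<integral>y. C \<partial>\<mu> (r n))"
    proof (intro integral_mono integrable_abs \<mu>.integrable_continuous continuous_on_entropy_fun_mult x)
      fix y assume "y \<in> space (\<mu> (r n))"
      then show "\<bar>entropy_fun (x * y)\<bar> \<le> C"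
        by (intro C prod01 x) (simp only: \<mu>.space_M)
    qed simp
    finally show ?thesis by (simp add: \<mu>.prob_space)
  qed
  have "(\<lambda>n. \<integral>\<omega>. K (\<mu> (r n)) (Zs n \<omega>) \<partial>\<Omega>) \<longlonglongrightarrow> (\<integral>\<omega>. K M (Z \<omega>) \<partial>\<Omega>)"
  proof (rule lim_int[of _ _ C])
    fix \<omega> assume \<omega>: "\<omega> \<in> space \<Omega>"
    \<comment> \<open>With \<open>\<omega>\<close> fixed, \<open>\<omega>'\<close> acts as the
      independent second sample. This inner limit is the pointwise convergence that the outer use of
      \<open>lim_int\<close> requires.\<close>
    have "(\<lambda>n. \<integral>\<omega>'. entropy_fun (Zs n \<omega> * Zs n \<omega>') \<partial>\<Omega>) \<longlonglongrightarrow> (\<integral>\<omega>'. entropy_fun (Z \<omega> * Z \<omega>') \<partial>\<Omega>)"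
      by (rule lim_int[of _ _ C])
        (intro continuous_on_entropy_fun_mult Z01 C prod01 H_lim tendsto_mult limZ \<omega> | assumption)+
    then show "(\<lambda>n. K (\<mu> (r n)) (Zs n \<omega>)) \<longlonglongrightarrow> K M (Z \<omega>)"
      unfolding K_def by (simp only: int\<mu> intM continuous_on_entropy_fun_mult Z01)
  qed (fact K_cont\<mu> K_contM K_bound)+
  then have "(\<lambda>n. \<integral>x. K (\<mu> (r n)) x \<partial>\<mu> (r n)) \<longlonglongrightarrow> (\<integral>x. K M x \<partial>M)"
    by (simp only: int\<mu>[OF K_cont\<mu>] intM[OF K_contM])
  then have "(\<lambda>n. entropy_functional (\<mu> (r n))) \<longlonglongrightarrow> entropy_functional M"
    unfolding \<mu>.entropy_functional_eq M.entropy_functional_eq K_def by (intro tendsto_diff ent_lim)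
  with r M mean_lim show thesis by (rule that)
qed

text \<open>The direct method: the functional is bounded below because entropy is bounded, and a
  subsequential limit of a minimizing sequence keeps the mean and attains the infimum.\<close>

lemma minimizer_exists:
  assumes \<phi>: "\<phi> \<in> {0..1}"
  obtains \<mu> where "is_minimizer \<phi> \<mu>"
proof -
  define S where "S = entropy_functional ` mean_measures \<phi>"
  have "return (restrict_space borel {0..1}) \<phi> \<in> mean_measures \<phi>"
    using unit_interval_prob_return[OF \<phi>] integral_return_continuous[OF \<phi> continuous_on_id]
    by (simp add: mean_measures_iff)
  then have ne: "S \<noteq> {}" by (auto simp: S_def)
  obtain C where C: "\<And>x. x \<in> {0..1} \<Longrightarrow> \<bar>entropy_fun x\<bar> \<le> C"
    using entropy_fun_bounded by blast
  have bdd: "bdd_below S"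
    unfolding S_def
  proof (rule bdd_belowI2)
    fix \<mu> assume "\<mu> \<in> mean_measures \<phi>"
    then interpret unit_interval_prob \<mu> by (simp add: mean_measures_iff)
    have "(\<integral>x. entropy_fun x \<partial>\<mu>) \<le> (\<integral>x. C \<partial>\<mu>)"
      by (intro integral_mono integrable_continuous continuous_on_entropy_fun)
        (use C in \<open>auto simp: space_M abs_le_iff\<close>)
    moreover have "(\<integral>x. -C \<partial>\<mu>) \<le> (\<integral>x. (\<integral>y. entropy_fun (x * y) \<partial>\<mu>) \<partial>\<mu>)"
    proof (intro integral_mono integrable_continuous continuous_on_integral_entropy_fun)
      fix x assume "x \<in> space \<mu>"
      then have x: "x \<in> {0..1}" by (simp add: space_M)
      have "(\<integral>y. -C \<partial>\<mu>) \<le> (\<integral>y. entropy_fun (x * y) \<partial>\<mu>)"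
      proof (intro integral_mono integrable_continuous continuous_on_entropy_fun_mult x)
        fix y assume "y \<in> space \<mu>"
        then have "x * y \<in> {0..1}" using x by (auto simp: space_M intro: mult_le_one)
        from C[OF this] show "-C \<le> entropy_fun (x * y)" by (simp add: abs_le_iff)
      qed simp
      then show "-C \<le> (\<integral>y. entropy_fun (x * y) \<partial>\<mu>)" by (simp add: prob_space)
    qed simp
    ultimately show "-C - C \<le> entropy_functional \<mu>"
      by (simp add: entropy_functional_eq prob_space)
  qed
  have "\<exists>\<mu>\<in>mean_measures \<phi>. entropy_functional \<mu> < Inf S + 1 / Suc n" for n
    using cInf_lessD[OF ne, of "Inf S + 1 / Suc n"] by (auto simp: S_def)
  then obtain \<mu> where \<mu>: "\<And>n. \<mu> n \<in> mean_measures \<phi>"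
    and less: "\<And>n. entropy_functional (\<mu> n) < Inf S + 1 / Suc n" by metis
  have "unit_interval_prob (\<mu> n)" for n using \<mu> by (simp add: mean_measures_iff)
  then obtain r M where r: "strict_mono r" and M: "unit_interval_prob M"
    and mean: "(\<lambda>n. \<integral>x. x \<partial>\<mu> (r n)) \<longlonglongrightarrow> (\<integral>x. x \<partial>M)"
    and lim: "(\<lambda>n. entropy_functional (\<mu> (r n))) \<longlonglongrightarrow> entropy_functional M"
    by (rule unit_interval_prob_convergent_subsequence)
  have "(\<integral>x. x \<partial>M) = \<phi>"
    using mean \<mu> by (simp add: mean_measures_iff LIMSEQ_const_iff)
  with M have M\<phi>: "M \<in> mean_measures \<phi>" by (simp add: mean_measures_iff)
  have "entropy_functional M \<le> Inf S"
  proof (rule LIMSEQ_le[OF lim])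
    have "((\<lambda>n. Inf S + 1 / Suc n) \<circ> r) \<longlonglongrightarrow> Inf S + 0"
      by (intro LIMSEQ_subseq_LIMSEQ[OF _ r] tendsto_intros lim_1_over_n LIMSEQ_Suc)
    then show "(\<lambda>n. Inf S + 1 / Suc (r n)) \<longlonglongrightarrow> Inf S" by (simp add: comp_def)
  qed (use less in \<open>auto intro: less_imp_le\<close>)
  then have "is_minimizer \<phi> M"
    unfolding is_minimizer_iff using M\<phi> cInf_lower[OF _ bdd] by (force simp: S_def)
  then show thesis by (rule that)
qed

section \<open>The support of a minimizer\<close>

text \<open>Both points would be zeros of the gap between the potential and its supporting line,
  whereas the gap is positive to the right of the smaller one. That point lies strictly inside the
  unit interval, which excludes the degenerate measures.\<close>

lemma minimizer_support_not_two_positive: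
  assumes min: "is_minimizer \<phi> \<mu>"
    and ab: "a \<in> measure_support \<mu>" "b \<in> measure_support \<mu>" "0 < a" "a < b"
  shows False
proof -
  interpret unit_interval_prob \<mu>
    using min by (simp add: is_minimizer_iff mean_measures_iff)
  have le: "entropy_functional \<mu> \<le> entropy_functional R"
    if "unit_interval_prob R" "(\<integral>x. x \<partial>R) = (\<integral>x. x \<partial>\<mu>)" for R
    using min that by (simp add: is_minimizer_iff mean_measures_iff)
  have b1: "b \<le> 1" using ab by (auto simp: measure_support_def space_M)
  \<comment> \<open>The support would otherwise consist of zeros of \<open>y * (1 - y)\<close>, but
    \<open>0 < a < 1\<close>.\<close>
  have nd: "\<not> (AE y in \<mu>. y = 0 \<or> y = 1)"
  proof
    assume "AE y in \<mu>. y = 0 \<or> y = 1"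
    then have "AE y in \<mu>. y * (1 - y) = 0" by eventually_elim auto
    from measure_support_subset_zeros[OF _ this ab(1)] have "a * (1 - a) = 0"
      by (simp add: continuous_intros)
    then show False using ab b1 by simp
  qed
  have id: "integrable \<mu> (\<lambda>x. x)" by (rule integrable_continuous) (rule continuous_on_id)
  \<comment> \<open>A mean of 0 or 1 forces all mass onto that endpoint, contrary to
    \<open>nd\<close>.\<close>
  have "(\<integral>x. x \<partial>\<mu>) \<noteq> 0"
  proof
    assume "(\<integral>x. x \<partial>\<mu>) = 0"
    then have "AE x in \<mu>. x = 0"
      by (subst integral_nonneg_eq_0_iff_AE[symmetric, OF id]) (auto simp: space_M)
    then have "AE y in \<mu>. y = 0 \<or> y = 1" by eventually_elim simp
    then show False using nd by simp
  qed
  moreover have "(\<integral>x. x \<partial>\<mu>) \<noteq> 1"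
  proof
    assume "(\<integral>x. x \<partial>\<mu>) = 1"
    then have "(\<integral>x. 1 - x \<partial>\<mu>) = 0" using id by (simp add: prob_space)
    then have "AE x in \<mu>. 1 - x = 0"
      using id by (subst integral_nonneg_eq_0_iff_AE[symmetric]) (auto simp: space_M)
    then have "AE y in \<mu>. y = 0 \<or> y = 1" by eventually_elim simp
    then show False using nd by simp
  qed
  moreover have "0 \<le> (\<integral>x. x \<partial>\<mu>)"
    by (rule integral_nonneg_AE) (auto simp: space_M)
  moreover have "(\<integral>x. x \<partial>\<mu>) \<le> (\<integral>x. 1 \<partial>\<mu>)"
    by (intro integral_mono id) (auto simp: space_M)
  ultimately have "0 < (\<integral>x. x \<partial>\<mu>)" "(\<integral>x. x \<partial>\<mu>) < 1" by (auto simp: prob_space)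
  then obtain c d where nonneg: "\<And>x. x \<in> {0..1} \<Longrightarrow> 0 \<le> potential x - (c * x + d)"
    and ae: "AE x in \<mu>. potential x - (c * x + d) = 0"
    using minimizer_supporting_line[OF le] by blast
  have cont: "continuous_on {0..1} (\<lambda>x. potential x - (c * x + d))"
    by (intro continuous_on_diff continuous_on_potential continuous_intros)
  from potential_minus_line_pos[OF nd nonneg ab(3,4) b1 measure_support_subset_zeros[OF cont ae ab(1)]]
    measure_support_subset_zeros[OF cont ae ab(2)]
  show False by simp
qed

theorem theorem1p1:
  fixes \<phi> :: real
  assumes "\<phi> \<in> {0..1}"
  shows "(\<exists>\<mu>. is_minimizer \<phi> \<mu> \<and> finite (measure_support \<mu>) \<and> card (measure_support \<mu>) \<le> 2) \<and>
         (\<forall>\<mu>. is_minimizer \<phi> \<mu> \<and> card (measure_support \<mu>) = 2 \<longrightarrow> 0 \<in> measure_support \<mu>)"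
proof -
  have nonneg: "0 \<le> x" if "is_minimizer \<phi> \<mu>" "x \<in> measure_support \<mu>" for \<mu> x
  proof -
    interpret unit_interval_prob \<mu>
      using that by (simp add: is_minimizer_iff mean_measures_iff)
    show ?thesis using that by (auto simp: measure_support_def space_M)
  qed
  have unique: "a = b"
    if "is_minimizer \<phi> \<mu>" "a \<in> measure_support \<mu>" "b \<in> measure_support \<mu>" "0 < a" "0 < b" for \<mu> a b
    using minimizer_support_not_two_positive that by (metis linorder_neqE_linordered_idom)
  obtain \<mu> where \<mu>: "is_minimizer \<phi> \<mu>"
    using minimizer_exists[OF assms] by blast
  \<comment> \<open>Here \<open>c\<close> is the only positive support point if there is one;
    otherwise any value serves.\<close>
  have "\<exists>c. measure_support \<mu> \<subseteq> {0, c}"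
  proof (cases "\<exists>c\<in>measure_support \<mu>. 0 < c")
    case True
    then show ?thesis using unique[OF \<mu>] nonneg[OF \<mu>] by (metis insert_iff less_eq_real_def subsetI)
  next
    case False
    then show ?thesis using nonneg[OF \<mu>] by force
  qed
  then obtain c where "measure_support \<mu> \<subseteq> {0, c}" by blast
  then have "finite (measure_support \<mu>)" "card (measure_support \<mu>) \<le> card {0, c}"
    by (auto intro: finite_subset card_mono)
  moreover have "card {0, c} \<le> 2" by (simp add: card_insert_if)
  \<comment> \<open>Of two distinct nonnegative support points at most one is positive, so the other
    is 0.\<close>
  moreover have "0 \<in> measure_support \<rho>" if "is_minimizer \<phi> \<rho>" "card (measure_support \<rho>) = 2" for \<rho>
    using that unique[OF that(1)] nonneg[OF that(1)]
    by (auto simp: card_2_iff less_eq_real_def)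
  ultimately show ?thesis using \<mu> by (meson le_trans)
qed

end
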